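(* (i) Let $k$ be a positive integer and $n=5k$. Then for every permutation $\pi\in S_n$, $c(\pi)\ge k+2$. (ii) In general, for a positive integer $n$, $$\min_{\pi\in S_n} c(\pi)=\left\lfloor \frac{n}{5}\right\rfloor+2 .$$
   Context: $n$ denotes a positive integer, and $S_n$ is the set of permutations of $[n]=\{1,\dots,n\}$, with $\pi\in S_n$ written as the sequence $(\pi(1),\dots,\pi(n))$. For indices $1\le i_1<i_2<\cdots<i_m\le n$, the subsequence $S=(\pi(i_1),\dots,\pi(i_m))$ is called caged if $\{\min(S),\max(S)\}=\{\pi(i_1),\pi(i_m)\}$, i.e. the first and last terms of $S$ are its minimum and maximum, in either order. The length of such a subsequence is its number of terms $m$. The caged length $c(\pi)$ is the length of any longest caged subsequence of $\pi$.
   Formalization: Part (ii) is stated for n ≥ 2 instead of all positive integers n: for n = 1 the only permutation (1) has caged length 1, while ⌊1/5⌋ + 2 = 2, so the claimed formula fails there. *)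

theory Defs
  imports "HOL-Combinatorics.Permutations" "HOL-Library.Sublist"
begin

definition perm_seq :: "nat \<Rightarrow> (nat \<Rightarrow> nat) \<Rightarrow> nat list" where
  "perm_seq n p = map p [1..<n + 1]"

(* Nonemptiness reflects that a subsequence has m >= 1 indices. One-term
   subsequences are caged, and so are all two-term ones. *)
definition caged :: "nat list \<Rightarrow> bool" where
  "caged S \<longleftrightarrow> S \<noteq> [] \<and> {Min (set S), Max (set S)} = {hd S, last S}"

(* For n >= 1 and p permuting {1..n} the set is finite and nonempty, so this
   is a genuine maximum; for n = 0 the value is junk. *)
definition caged_length :: "nat \<Rightarrow> (nat \<Rightarrow> nat) \<Rightarrow> nat" where
  "caged_length n p = Max {length S | S. subseq S (perm_seq n p) \<and> caged S}"

end

theory Submission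
  imports Defs
begin

text \<open>
  A longest caged subsequence with end positions \<open>i \<le> j\<close> consists of all points of the graph of
  the permutation in the rectangle spanned by its two end points.

  Lower bound: let \<open>A\<close>, \<open>B\<close>, \<open>C\<close>, \<open>D\<close> be the leftmost, rightmost, topmost and bottommost points.
  The rectangles \<open>AB\<close>, \<open>AC\<close>, \<open>CB\<close>, \<open>AD\<close>, \<open>DB\<close> cover the whole graph, so if each of them had at most
  \<open>k - 1\<close> points besides its corners, there would be at most \<open>4 + 5 (k - 1) < 5 k\<close> points.

  Upper bound: blow up the permutation \<open>25314\<close> into five blocks of \<open>k\<close> points, the outer ones
  alternately increasing and decreasing, and add four extreme points, one on each side of the
  central block. Any rectangle spanned by two of these \<open>5 k + 4\<close> points has, besides its corners,
  only points of a single block. Smaller sizes are obtained by deleting the largest values.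
\<close>

section \<open>Caged subsequences as point sets of rectangles\<close>

definition box :: "(nat \<Rightarrow> nat) \<Rightarrow> nat \<Rightarrow> nat \<Rightarrow> nat set" where
  "box p i j = {w \<in> {i..j}. min (p i) (p j) \<le> p w \<and> p w \<le> max (p i) (p j)}"

lemma finite_box [simp]: "finite (box p i j)"
  by (simp add: box_def)

lemma finite_caged_lengths: "finite {length S | S. subseq S xs \<and> caged S}"
proof (rule finite_subset)
  show "{length S | S. subseq S xs \<and> caged S} \<subseteq> {..length xs}"
    by (auto dest: list_emb_length)
qed simp

text \<open>Read from left to right, the points of the rectangle form a caged subsequence: the two
  corners are its end terms and also its extreme values.\<close>

lemma card_box_le_caged_length:
  assumes "1 \<le> i" "i \<le> j" "j \<le> n"
  shows "card (box p i j) \<le> caged_length n p"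
proof -
  define P where "P w \<longleftrightarrow> min (p i) (p j) \<le> p w \<and> p w \<le> max (p i) (p j)" for w
  define J where "J = filter P [i..<Suc j]"
  have P: "P i" "P j"
    by (auto simp: P_def)
  have setJ: "set J = box p i j"
    by (auto simp: J_def P_def box_def)
  have len: "length (map p J) = card (box p i j)"
  proof -
    have "distinct J"
      by (simp add: J_def)
    then show ?thesis
      by (metis distinct_card length_map setJ)
  qed
  have hd: "J \<noteq> []" "hd J = i"
    using P assms by (simp_all add: J_def upt_conv_Cons del: upt_Suc)
  have last: "last J = j"
    using P assms by (simp add: J_def)
  have Min: "Min (p ` set J) = min (p i) (p j)"
    using assms by (intro Min_eqI) (auto simp: setJ box_def min_def)
  have Max: "Max (p ` set J) = max (p i) (p j)"
    using assms by (intro Max_eqI) (auto simp: setJ box_def max_def)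
  have "caged (map p J)"
    unfolding caged_def using hd last Min Max
    by (auto simp: hd_map last_map min_def max_def)
  moreover have "subseq (map p J) (perm_seq n p)"
  proof -
    have "[1..<n + 1] = [1..<i] @ [i..<n + 1]"
      using upt_add_eq_append[of 1 i "n + 1 - i"] assms by simp
    moreover have "[i..<n + 1] = [i..<Suc j] @ [Suc j..<n + 1]"
      using upt_add_eq_append[of i "Suc j" "n - j"] assms by simp
    ultimately have "[1..<n + 1] = ([1..<i] @ [i..<Suc j]) @ [Suc j..<n + 1]"
      by (simp del: upt_Suc)
    then have "subseq [i..<Suc j] [1..<n + 1]"
      by (simp only: subseq_drop_many subseq_rev_drop_many subseq_order.order_refl)
    then have "subseq J [1..<n + 1]"
      unfolding J_def by (meson subseq_filter_left subseq_order.order_trans)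
    then show ?thesis
      unfolding perm_seq_def by (rule subseq_map)
  qed
  ultimately show ?thesis
    unfolding caged_length_def len[symmetric] by (intro Max_ge finite_caged_lengths CollectI) blast
qed

text \<open>All positions of a caged subsequence lie in the rectangle of its first and last.
  Bounding a single \<open>S\<close> instead of \<open>caged_length\<close> allows the use inside a
  longer sequence.\<close>

lemma caged_subseq_length_le:
  assumes S: "subseq S (perm_seq n p)" "caged S"
    and le: "\<And>i j. 1 \<le> i \<Longrightarrow> i \<le> j \<Longrightarrow> j \<le> n \<Longrightarrow> card (box p i j) \<le> m"
  shows "length S \<le> m"
proof -
  obtain N where "S = nths (perm_seq n p) N"
    using S by (auto simp: subseq_conv_nths)
  then obtain J where J: "S = map p J" "J = nths [1..<n + 1] N"
    by (simp add: perm_seq_def nths_map)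
  have sorted: "sorted J" and dist: "distinct J" and sub: "set J \<subseteq> {1..n}"
    using J by (auto simp: sorted_nths distinct_nthsI dest: in_set_nthsD simp del: upt_Suc)
  have ne: "J \<noteq> []"
    using S J by (auto simp: caged_def)
  have bounds: "hd J \<le> w \<and> w \<le> last J" if "w \<in> set J" for w
  proof
    show "hd J \<le> w"
      using sorted that by (cases J) auto
    have "sorted (butlast J @ [last J])" "w \<in> set (butlast J @ [last J])"
      using sorted ne that by simp_all
    then show "w \<le> last J"
      unfolding sorted_append by auto
  qed
  have eq: "{Min (p ` set J), Max (p ` set J)} = {p (hd J), p (last J)}"
    using S J ne by (simp add: caged_def hd_map last_map)
  have "w \<in> box p (hd J) (last J)" if w: "w \<in> set J" for w
  proof -
    have "Min (p ` set J) \<le> p w" "p w \<le> Max (p ` set J)"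
      using w by auto
    then show ?thesis
      using eq bounds[OF w] unfolding box_def doubleton_eq_iff by auto
  qed
  then have "card (set J) \<le> card (box p (hd J) (last J))"
    by (intro card_mono) auto
  also have "\<dots> \<le> m"
    using le bounds sub ne by (meson atLeastAtMost_iff hd_in_set last_in_set subsetD)
  finally show ?thesis
    using J dist by (simp add: distinct_card)
qed

lemma caged_length_le:
  assumes "n \<ge> 1" "\<And>S. subseq S (perm_seq n p) \<Longrightarrow> caged S \<Longrightarrow> length S \<le> m"
  shows "caged_length n p \<le> m"
proof -
  have "subseq [p 1] (perm_seq n p)" "caged [p 1]"
    using assms(1) by (auto simp: perm_seq_def caged_def upt_conv_Cons simp del: upt_Suc)
  then have "{length S | S. subseq S (perm_seq n p) \<and> caged S} \<noteq> {}"
    by blast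
  then show ?thesis
    unfolding caged_length_def using assms(2) finite_caged_lengths by (subst Max_le_iff) auto
qed

section \<open>The lower bound\<close>

lemma caged_length_ge:
  assumes p: "p permutes {1..n}" and n: "n \<ge> 2"
  shows "n div 5 + 2 \<le> caged_length n p"
proof (rule ccontr)
  define k where "k = n div 5"
  assume "\<not> ?thesis"
  then have less: "caged_length n p < k + 2"
    by (simp add: k_def)
  have small: "card (box p i j) < k + 2" if "1 \<le> i" "i \<le> j" "j \<le> n" for i j
    using card_box_le_caged_length[OF that, of p] less by simp
  \<comment> \<open>The first two terms are caged, which forces \<open>k \<ge> 1\<close> and keeps
    \<open>k - 1\<close> from being truncated. With \<open>n = 1\<close> there is no such pair, and
    the bound fails.\<close>
  have "box p 1 2 = {1, 2}"
    unfolding box_def by (auto simp: min_def max_def le_Suc_eq numeral_2_eq_2)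
  then have "card (box p 1 2) = 2"
    by simp
  then have k: "k \<ge> 1"
    using small[of 1 2] n by simp
  have inner: "card (box p i j - {i, j}) \<le> k - 1" if "1 \<le> i" "i \<le> j" "j \<le> n" for i j
  \<comment> \<open>Rectangles can degenerate, since \<open>c\<close> or \<open>d\<close> may be
    \<open>1\<close> or \<open>n\<close>.\<close>
  proof (cases "i = j")
    case True
    then have "box p i j - {i, j} = {}"
      by (auto simp: box_def)
    then show ?thesis
      by (metis card.empty le0)
  next
    case False
    have "{i, j} \<subseteq> box p i j"
      using that by (auto simp: box_def)
    then have "card (box p i j - {i, j}) = card (box p i j) - 2"
      using False by (simp add: card_Diff_subset)
    then show ?thesis
      using small[OF that] by simp
  qed
  note img = permutes_image[OF p]
  have "n \<in> p ` {1..n}"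
    unfolding img using n by simp
  then obtain c where "n = p c" "c \<in> {1..n}"
    by (rule imageE)
  then have c: "c \<in> {1..n}" "p c = n"
    by simp_all
  have "1 \<in> p ` {1..n}"
    unfolding img using n by simp
  then obtain d where "1 = p d" "d \<in> {1..n}"
    by (rule imageE)
  then have d: "d \<in> {1..n}" "p d = 1"
    by simp_all
  \<comment> \<open>As a list, so that \<open>card_length\<close> bounds the number of sets by five
    even when some of them coincide.\<close>
  define bs where "bs = [box p 1 n - {1, n}, box p 1 c - {1, c}, box p c n - {c, n},
    box p 1 d - {1, d}, box p d n - {d, n}]"
  have "{1..n} \<subseteq> {1, n, c, d} \<union> \<Union> (set bs)"
  proof
    fix w assume w: "w \<in> {1..n}"
    then have "p w \<in> {1..n}"
      using img by blast
    then have pw: "1 \<le> p w" "p w \<le> n"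
      by simp_all
    consider "min (p 1) (p n) \<le> p w" "p w \<le> max (p 1) (p n)"
      | "max (p 1) (p n) < p w" "w \<le> c" | "max (p 1) (p n) < p w" "c \<le> w"
      | "p w < min (p 1) (p n)" "w \<le> d" | "p w < min (p 1) (p n)" "d \<le> w"
      using linorder_le_cases[of w c] linorder_le_cases[of w d] linorder_not_le by metis
    then have "w \<in> box p 1 n \<or> w \<in> box p 1 c \<or> w \<in> box p c n \<or> w \<in> box p 1 d \<or> w \<in> box p d n"
    proof cases
      case 1
      then show ?thesis using w by (simp add: box_def)
    next
      case 2
      then have "w \<in> box p 1 c" using w c pw by (simp add: box_def)
      then show ?thesis by blast
    next
      case 3
      then have "w \<in> box p c n" using w c pw by (simp add: box_def)
      then show ?thesis by blast
    next
      case 4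
      then have "w \<in> box p 1 d" using w d pw by (simp add: box_def)
      then show ?thesis by blast
    next
      case 5
      then have "w \<in> box p d n" using w d pw by (simp add: box_def)
      then show ?thesis by blast
    qed
    then show "w \<in> {1, n, c, d} \<union> \<Union> (set bs)"
      unfolding bs_def by (simp, blast)
  qed
  then have "card {1..n} \<le> card ({1, n, c, d} \<union> \<Union> (set bs))"
    by (intro card_mono) (auto simp: bs_def)
  also have "\<dots> \<le> card {1, n, c, d} + card (\<Union> (set bs))"
    by (rule card_Un_le)
  also have "card {1, n, c, d} \<le> 4"
    by (simp add: card_insert_if)
  also have "card (\<Union> (set bs)) \<le> (\<Sum>b\<in>set bs. card b)"
    by (rule card_Union_le_sum_card)
  also have "(\<Sum>b\<in>set bs. card b) \<le> (\<Sum>b\<in>set bs. k - 1)"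
    using inner c d n by (intro sum_mono) (auto simp: bs_def)
  also have "\<dots> \<le> 5 * (k - 1)"
    using card_length[of bs] by (simp add: bs_def)
  finally show False
    using k unfolding k_def by simp
qed

section \<open>The extremal permutation\<close>

text \<open>
  The lines with \<open>2 * k + 2\<close>, \<open>5 * k + 4\<close>, \<open>1\<close> and \<open>3 * k + 3\<close> are the extreme points
  \<open>A\<close>, \<open>C\<close>, \<open>D\<close> and \<open>B\<close>; the other five are the blocks.
\<close>

definition extremal_perm :: "nat \<Rightarrow> nat \<Rightarrow> nat" where
  "extremal_perm k i =
    (if i \<le> 1 then 2 * k + 2
     else if i \<le> k + 1 then 2 * k + 3 - i
     else if i \<le> 2 * k + 1 then i + 3 * k + 2
     else if i = 2 * k + 2 then 5 * k + 4
     else if i \<le> 3 * k + 2 then i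
     else if i = 3 * k + 3 then 1
     else if i \<le> 4 * k + 3 then i - (3 * k + 2)
     else if i \<le> 5 * k + 3 then 8 * k + 7 - i
     else 3 * k + 3)"

text \<open>The values are given by equations without truncated subtraction, so that
  \<open>linarith\<close> can settle the case distinctions that follow.\<close>

lemma extremal_perm_cases:
  assumes "1 \<le> i" "i \<le> 5 * k + 4"
  obtains "i = 1" "extremal_perm k i = 2 * k + 2"
    | "2 \<le> i" "i \<le> k + 1" "extremal_perm k i + i = 2 * k + 3"
    | "k + 2 \<le> i" "i \<le> 2 * k + 1" "extremal_perm k i = i + 3 * k + 2"
    | "i = 2 * k + 2" "extremal_perm k i = 5 * k + 4"
    | "2 * k + 3 \<le> i" "i \<le> 3 * k + 2" "extremal_perm k i = i"
    | "i = 3 * k + 3" "extremal_perm k i = 1"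
    | "3 * k + 4 \<le> i" "i \<le> 4 * k + 3" "extremal_perm k i + (3 * k + 2) = i"
    | "4 * k + 4 \<le> i" "i \<le> 5 * k + 3" "extremal_perm k i + i = 8 * k + 7"
    | "i = 5 * k + 4" "extremal_perm k i = 3 * k + 3"
proof -
  have "i = 1 \<or> 2 \<le> i \<and> i \<le> k + 1 \<or> k + 2 \<le> i \<and> i \<le> 2 * k + 1 \<or> i = 2 * k + 2 \<or>
      2 * k + 3 \<le> i \<and> i \<le> 3 * k + 2 \<or> i = 3 * k + 3 \<or> 3 * k + 4 \<le> i \<and> i \<le> 4 * k + 3 \<or>
      4 * k + 4 \<le> i \<and> i \<le> 5 * k + 3 \<or> i = 5 * k + 4"
    using assms by linarith
  then show thesis
    using that unfolding extremal_perm_def by (elim disjE conjE; simp)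
qed

lemma extremal_perm_bounds:
  assumes "i \<in> {1..5 * k + 4}"
  shows "extremal_perm k i \<in> {1..5 * k + 4}"
  by (rule extremal_perm_cases[of i k]) (use assms in auto)

lemma extremal_perm_inj: "inj_on (extremal_perm k) {1..5 * k + 4}"
proof (rule inj_onI)
  fix i j assume ij: "i \<in> {1..5 * k + 4}" "j \<in> {1..5 * k + 4}"
    and eq: "extremal_perm k i = extremal_perm k j"
  show "i = j"
  proof -
    have "1 \<le> i" "i \<le> 5 * k + 4" and "1 \<le> j" "j \<le> 5 * k + 4"
      using ij by auto
    note i = extremal_perm_cases[OF this(1,2)] and j = extremal_perm_cases[OF this(3,4)]
    show ?thesis
      by (rule i; rule j; use eq in linarith)
  qed
qed

lemma extremal_perm_image: "extremal_perm k ` {1..5 * k + 4} = {1..5 * k + 4}"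
  using extremal_perm_bounds extremal_perm_inj by (intro endo_inj_surj) auto

text \<open>A block occupies \<open>k\<close> consecutive positions, hence the interval. Each
  extreme point prolongs the monotone run of an adjacent outer block, so the choice of
  \<open>a\<close> only needs five ranges of positions: four such runs and the central
  block.\<close>

lemma extremal_perm_inner:
  assumes "1 \<le> u" "v \<le> 5 * k + 4"
  shows "\<exists>a. box (extremal_perm k) u v - {u, v} \<subseteq> {a..<a + k}"
proof -
  let ?f = "extremal_perm k"
  \<comment> \<open>the first position of the only block with points inside the rectangle\<close>
  define a where "a =
    (if u \<le> k + 1 then
       (if v \<le> k + 1 then 2 else if v \<le> 2 * k + 2 then k + 2 else if v \<le> 3 * k + 2 then 2 * k + 3
        else if v \<le> 4 * k + 3 then 2 else 2 * k + 3)
     else if u \<le> 2 * k + 2 then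
       (if v \<le> 2 * k + 2 then k + 2 else if v \<le> 4 * k + 3 then 2 * k + 3 else 4 * k + 4)
     else if u \<le> 3 * k + 2 then 2 * k + 3
     else if u \<le> 4 * k + 3 then 3 * k + 4
     else 4 * k + 4)"
  have a_cases: "u \<le> k + 1 \<and> v \<le> k + 1 \<and> a = 2
    \<or> u \<le> k + 1 \<and> k + 1 < v \<and> v \<le> 2 * k + 2 \<and> a = k + 2
    \<or> u \<le> k + 1 \<and> 2 * k + 2 < v \<and> v \<le> 3 * k + 2 \<and> a = 2 * k + 3
    \<or> u \<le> k + 1 \<and> 3 * k + 2 < v \<and> v \<le> 4 * k + 3 \<and> a = 2
    \<or> u \<le> k + 1 \<and> 4 * k + 3 < v \<and> a = 2 * k + 3
    \<or> k + 1 < u \<and> u \<le> 2 * k + 2 \<and> v \<le> 2 * k + 2 \<and> a = k + 2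
    \<or> k + 1 < u \<and> u \<le> 2 * k + 2 \<and> 2 * k + 2 < v \<and> v \<le> 4 * k + 3 \<and> a = 2 * k + 3
    \<or> k + 1 < u \<and> u \<le> 2 * k + 2 \<and> 4 * k + 3 < v \<and> a = 4 * k + 4
    \<or> 2 * k + 2 < u \<and> u \<le> 3 * k + 2 \<and> a = 2 * k + 3
    \<or> 3 * k + 2 < u \<and> u \<le> 4 * k + 3 \<and> a = 3 * k + 4
    \<or> 4 * k + 3 < u \<and> a = 4 * k + 4"
    using a_def unfolding linorder_not_le[symmetric] by metis
  have "a \<le> w \<and> w < a + k"
    if w: "u < w" "w < v" "?f u \<le> ?f w \<and> ?f w \<le> ?f v \<or> ?f v \<le> ?f w \<and> ?f w \<le> ?f u" for w
  proof -
    have "1 \<le> w" "w \<le> 5 * k + 4" and "u \<le> 5 * k + 4" and "1 \<le> v"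
      using assms w by linarith+
    note cases_w = extremal_perm_cases[OF this(1,2)]
      and cases_u = extremal_perm_cases[OF assms(1) this(3)]
      and cases_v = extremal_perm_cases[OF this(4) assms(2)]
    show ?thesis
      \<comment> \<open>Impossible combinations are discarded as soon as they arise, before the next
        ninefold split.\<close>
      by (insert a_cases w; elim disjE conjE;
          rule cases_u; linarith?; rule cases_v; linarith?; rule cases_w; linarith)
  qed
  then have "a \<le> w \<and> w < a + k" if "w \<in> box ?f u v - {u, v}" for w
    using that unfolding box_def by (cases "?f u \<le> ?f v") auto
  then have "box ?f u v - {u, v} \<subseteq> {a..<a + k}"
    unfolding atLeastLessThan_iff[symmetric] by (rule subsetI)
  then show ?thesis ..
qed

lemma card_box_extremal_perm_le:
  assumes "1 \<le> u" "v \<le> 5 * k + 4"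
  shows "card (box (extremal_perm k) u v) \<le> k + 2"
proof -
  obtain a where a: "box (extremal_perm k) u v - {u, v} \<subseteq> {a..<a + k}"
    using extremal_perm_inner[OF assms] by blast
  then have "box (extremal_perm k) u v \<subseteq> {u, v} \<union> {a..<a + k}"
    by blast
  then have "card (box (extremal_perm k) u v) \<le> card ({u, v} \<union> {a..<a + k})"
    by (intro card_mono) auto
  also have "\<dots> \<le> card {u, v} + card {a..<a + k}"
    by (rule card_Un_le)
  also have "\<dots> \<le> k + 2"
    by (simp add: card_insert_if)
  finally show ?thesis .
qed

section \<open>The upper bound for every length\<close>

lemma obtain_perm_of_list:
  assumes "distinct xs" "set xs = {1..n}"
  obtains p where "p permutes {1..n}" "perm_seq n p = xs"
proof
  have len: "length xs = n"
    using distinct_card[OF assms(1)] assms(2) by simp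
  \<comment> \<open>Positions start at 1, list indices at 0; outside the range
    \<open>permutes\<close> demands the identity.\<close>
  define p where "p i = (if i \<in> {1..n} then xs ! (i - 1) else i)" for i
  show "perm_seq n p = xs"
    unfolding perm_seq_def by (rule nth_equalityI) (simp_all add: len p_def del: upt_Suc)
  then have "p ` {1..n} = {1..n}"
    using assms(2) by (metis perm_seq_def Suc_eq_plus1 atLeastLessThanSuc_atLeastAtMost set_map set_upt)
  then have "bij_betw p {1..n} {1..n}"
    by (simp add: bij_betw_def finite_surj_inj)
  then show "p permutes {1..n}"
    by (rule bij_imp_permutes) (auto simp: p_def)
qed

text \<open>Being caged depends only on the terms, so deleting the values above \<open>n\<close>
  from the extremal sequence creates no new caged subsequences.\<close>

lemma exists_caged_length_le:
  assumes "n \<ge> 1"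
  shows "\<exists>p. p permutes {1..n} \<and> caged_length n p \<le> n div 5 + 2"
proof -
  define k where "k = n div 5"
  \<comment> \<open>The largest length with the same quotient by 5 as \<open>n\<close>.\<close>
  define N where "N = 5 * k + 4"
  define L where "L = perm_seq N (extremal_perm k)"
  have n: "n \<le> N"
    by (simp add: N_def k_def)
  have set_range: "set [1..<N + 1] = {1..N}"
    by auto
  have L: "distinct L" "set L = {1..N}"
    using extremal_perm_inj[of k] extremal_perm_image[of k] set_range
    unfolding L_def perm_seq_def N_def by (simp_all add: distinct_map del: upt_Suc set_upt)
  obtain p where p: "p permutes {1..n}" "perm_seq n p = filter (\<lambda>x. x \<le> n) L"
    using L n by (auto intro: obtain_perm_of_list[of "filter (\<lambda>x. x \<le> n) L" n])
  have "caged_length n p \<le> k + 2"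
  proof (rule caged_length_le[OF assms])
    fix S assume S: "subseq S (perm_seq n p)" "caged S"
    then have "subseq S L"
      unfolding p by (meson subseq_filter_left subseq_order.order_trans)
    then show "length S \<le> k + 2"
      unfolding L_def using S(2) card_box_extremal_perm_le
      by (rule caged_subseq_length_le) (simp_all add: N_def)
  qed
  then show ?thesis
    using p k_def by blast
qed

theorem theorem1p1:
  "(\<forall>k n :: nat. k \<ge> 1 \<longrightarrow> n = 5 * k \<longrightarrow>
      (\<forall>p. p permutes {1..n} \<longrightarrow> caged_length n p \<ge> k + 2)) \<and>
   (\<forall>n :: nat. n \<ge> 2 \<longrightarrow>
      Min {caged_length n p | p. p permutes {1..n}} = n div 5 + 2)"
proof (intro conjI allI impI)
  fix k n :: nat and p
  assume "k \<ge> 1" "n = 5 * k" "p permutes {1..n}"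
  then show "caged_length n p \<ge> k + 2"
    using caged_length_ge[of p n] by simp
next
  fix n :: nat
  assume n: "n \<ge> 2"
  obtain p where p: "p permutes {1..n}" "caged_length n p \<le> n div 5 + 2"
    using exists_caged_length_le n by (meson one_le_numeral order.trans)
  show "Min {caged_length n p | p. p permutes {1..n}} = n div 5 + 2"
  proof (rule Min_eqI)
    show "finite {caged_length n p | p. p permutes {1..n}}"
      by (simp add: finite_permutations)
    show "n div 5 + 2 \<in> {caged_length n p | p. p permutes {1..n}}"
      using p caged_length_ge[OF p(1) n] by (auto intro: antisym)
  qed (use caged_length_ge n in auto)
qed

end
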